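(* For any nontrivial tree $T$, $0<\frac{\gamma(T)}{\gamma_{sp}(T)}\leq 1$. Moreover, a nontrivial tree $T$ satisfies $\frac{\gamma(T)}{\gamma_{sp}(T)}=1$ if and only if $T$ is the corona $H\circ K_1$ for some tree $H$.
   Context: $\gamma(G)$ is the domination number of $G$. For $S\subseteq V(G)$, $\overline{S}=V(G)\setminus S$. A set $S\subseteq V(G)$ is a super dominating set if for every $u\in\overline{S}$ there exists $v\in S$ with $N(v)\cap\overline{S}=\{u\}$, where $N(v)$ is the open neighborhood of $v$; $\gamma_{sp}(G)$ is the minimum cardinality of a super dominating set. The corona $H\circ K_1$ is the graph obtained from $H$ by attaching a new leaf to each vertex of $H$. A nontrivial tree is a tree with at least two vertices. *)

theory Defs
  imports Complex_Main "Graph_Theory.Graph_Theory"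
begin

text \<open>
  Finite simple graphs are the symmetric loop-free pair digraphs of the Graph Theory library
  (locale \<^locale>\<open>pair_graph\<close>): every edge is represented by its two arcs.
\<close>

text \<open>
  The library's \<^const>\<open>tree\<close> is not usable for symmetric digraphs: there a back-and-forth walk
  along a single edge counts as a cycle of length 2. The cycles of an undirected simple graph are
  exactly the library cycles of length at least 3. Connectedness entails that there is at least
  one vertex.
\<close>

definition undirected_tree :: "'a pair_pre_digraph \<Rightarrow> bool" where
  "undirected_tree G \<longleftrightarrow> pair_graph G \<and> Digraph_Component.connected (with_proj G) \<and>
     \<not> (\<exists>p. pre_digraph.cycle (with_proj G) p \<and> 3 \<le> length p)"

definition nontrivial_tree :: "'a pair_pre_digraph \<Rightarrow> bool" where
  "nontrivial_tree G \<longleftrightarrow> undirected_tree G \<and> 2 \<le> card (pverts G)"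

definition open_neighborhood :: "'a pair_pre_digraph \<Rightarrow> 'a \<Rightarrow> 'a set" where
  "open_neighborhood G v = {u \<in> pverts G. (v, u) \<in> parcs G}"

definition dominating_set :: "'a pair_pre_digraph \<Rightarrow> 'a set \<Rightarrow> bool" where
  "dominating_set G S \<longleftrightarrow> S \<subseteq> pverts G \<and>
     (\<forall>u \<in> pverts G - S. \<exists>v \<in> S. u \<in> open_neighborhood G v)"

definition domination_number :: "'a pair_pre_digraph \<Rightarrow> nat" where
  "domination_number G = Min (card ` {S. dominating_set G S})"

definition super_dominating_set :: "'a pair_pre_digraph \<Rightarrow> 'a set \<Rightarrow> bool" where
  "super_dominating_set G S \<longleftrightarrow> S \<subseteq> pverts G \<and>
     (\<forall>u \<in> pverts G - S. \<exists>v \<in> S. open_neighborhood G v \<inter> (pverts G - S) = {u})"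

definition super_domination_number :: "'a pair_pre_digraph \<Rightarrow> nat" where
  "super_domination_number G = Min (card ` {S. super_dominating_set G S})"

text \<open>
  The corona of \<open>H\<close> with the one-vertex graph: \<open>Inl v\<close> is the copy of the vertex \<open>v\<close> of \<open>H\<close>,
  and \<open>Inr v\<close> is the new leaf attached to it.
\<close>

definition corona_K1 :: "'a pair_pre_digraph \<Rightarrow> ('a + 'a) pair_pre_digraph" where
  "corona_K1 H = \<lparr>
     pverts = Inl ` pverts H \<union> Inr ` pverts H,
     parcs = {(Inl u, Inl v) | u v. (u, v) \<in> parcs H}
       \<union> {(Inl v, Inr v) | v. v \<in> pverts H}
       \<union> {(Inr v, Inl v) | v. v \<in> pverts H} \<rparr>"

end

theory Submission
  imports Defs
begin

text \<open>
  A super dominating set dominates, and the vertices outside it are matched injectively into it,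
  while the complement of a minimum dominating set dominates. Hence equality of the two numbers
  forces both to be half the order, and a minimum super dominating set \<open>S\<close> is then joined to its
  complement by exactly a perfect matching. If some matching edge \<open>uv\<close> had no leaf as an endpoint,
  then cutting the tree at \<open>uv\<close> and taking the vertices of \<open>S\<close> on one side and those outside \<open>S\<close> on
  the other side, but neither \<open>u\<close> nor \<open>v\<close>, would give a dominating set that is too small. So every
  matching edge ends in a leaf, which is the structure of a corona.
\<close>

section \<open>Domination and super domination\<close>

lemma domination_number_le:
  assumes "finite (pverts G)" "dominating_set G S"
  shows "domination_number G \<le> card S"
proof -
  have "{S. dominating_set G S} \<subseteq> Pow (pverts G)"
    by (auto simp: dominating_set_def)
  then have "finite {S. dominating_set G S}"
    by (rule finite_subset) (simp add: assms(1))
  then show ?thesis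
    unfolding domination_number_def using assms(2) by (intro Min_le) auto
qed

lemma domination_number_attained:
  assumes "finite (pverts G)"
  obtains S where "dominating_set G S" "card S = domination_number G"
proof -
  have "{S. dominating_set G S} \<subseteq> Pow (pverts G)"
    by (auto simp: dominating_set_def)
  then have "finite {S. dominating_set G S}"
    by (rule finite_subset) (simp add: assms)
  \<comment> \<open>The family is nonempty, so \<open>Min\<close> is attained rather than
    unspecified.\<close>
  moreover have "dominating_set G (pverts G)"
    by (simp add: dominating_set_def)
  ultimately have "domination_number G \<in> card ` {S. dominating_set G S}"
    unfolding domination_number_def by (intro Min_in) auto
  then show thesis using that by auto
qed

lemma super_domination_number_le:
  assumes "finite (pverts G)" "super_dominating_set G S"
  shows "super_domination_number G \<le> card S"
proof -
  have "{S. super_dominating_set G S} \<subseteq> Pow (pverts G)"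
    by (auto simp: super_dominating_set_def)
  then have "finite {S. super_dominating_set G S}"
    by (rule finite_subset) (simp add: assms(1))
  then show ?thesis
    unfolding super_domination_number_def using assms(2) by (intro Min_le) auto
qed

lemma super_domination_number_attained:
  assumes "finite (pverts G)"
  obtains S where "super_dominating_set G S" "card S = super_domination_number G"
proof -
  have "{S. super_dominating_set G S} \<subseteq> Pow (pverts G)"
    by (auto simp: super_dominating_set_def)
  then have "finite {S. super_dominating_set G S}"
    by (rule finite_subset) (simp add: assms)
  moreover have "super_dominating_set G (pverts G)"
    by (simp add: super_dominating_set_def)
  ultimately have "super_domination_number G \<in> card ` {S. super_dominating_set G S}"
    unfolding super_domination_number_def by (intro Min_in) auto
  then show thesis using that by auto
qed

lemma super_dominating_set_imp_dominating_set:
  "super_dominating_set G S \<Longrightarrow> dominating_set G S"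
  unfolding super_dominating_set_def dominating_set_def by blast

lemma domination_number_le_super_domination_number:
  assumes "finite (pverts G)"
  shows "domination_number G \<le> super_domination_number G"
  by (metis assms domination_number_le super_dominating_set_imp_dominating_set
      super_domination_number_attained)

lemma domination_number_pos:
  assumes "finite (pverts G)" "pverts G \<noteq> {}"
  shows "0 < domination_number G"
proof -
  obtain S where S: "dominating_set G S" "card S = domination_number G"
    using domination_number_attained[OF assms(1)] .
  have "S \<noteq> {}" "finite S"
    using S(1) assms by (auto simp: dominating_set_def intro: finite_subset)
  then show ?thesis using S(2) by (metis card_gt_0_iff)
qed

text \<open>Any choice of private neighbors is injective: \<open>f u\<close> alone determines the
  intersection \<open>{u}\<close>, hence \<open>u\<close>.\<close>

lemma super_dominating_set_private_neighbors:
  assumes "super_dominating_set G S"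
  obtains f where "f ` (pverts G - S) \<subseteq> S" "inj_on f (pverts G - S)"
    "\<And>u. u \<in> pverts G - S \<Longrightarrow> open_neighborhood G (f u) \<inter> (pverts G - S) = {u}"
proof -
  have "\<forall>u \<in> pverts G - S. \<exists>v \<in> S. open_neighborhood G v \<inter> (pverts G - S) = {u}"
    using assms by (simp add: super_dominating_set_def)
  then obtain f where f: "\<forall>u \<in> pverts G - S. f u \<in> S \<and>
      open_neighborhood G (f u) \<inter> (pverts G - S) = {u}"
    by metis
  have "inj_on f (pverts G - S)"
    using f by (intro inj_onI) (metis singleton_inject)
  then show thesis using f that by blast
qed

section \<open>Bounds by half the order\<close>

lemma card_le_double_super_domination_number:
  assumes "finite (pverts G)"
  shows "card (pverts G) \<le> 2 * super_domination_number G"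
proof -
  obtain S where S: "super_dominating_set G S" "card S = super_domination_number G"
    using super_domination_number_attained[OF assms] .
  have sub: "S \<subseteq> pverts G" using S(1) by (simp add: super_dominating_set_def)
  then have fin: "finite S" using assms by (rule finite_subset)
  obtain f where "f ` (pverts G - S) \<subseteq> S" "inj_on f (pverts G - S)"
    using super_dominating_set_private_neighbors[OF S(1)] by metis
  then have "card (pverts G - S) \<le> card S"
    using fin by (metis card_inj_on_le)
  then show ?thesis
    using S(2) card_Diff_subset[OF fin sub] card_mono[OF assms sub] by linarith
qed

text \<open>Ore's bound.\<close>

lemma double_domination_number_le_card:
  assumes "pair_graph G"
    and noiso: "\<And>x. x \<in> pverts G \<Longrightarrow> \<exists>y. (x, y) \<in> parcs G"
  shows "2 * domination_number G \<le> card (pverts G)"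
proof -
  interpret pair_graph G by fact
  have fin: "finite (pverts G)" by (rule pair_finite_verts)
  obtain D where D: "dominating_set G D" "card D = domination_number G"
    using domination_number_attained[OF fin] .
  have sub: "D \<subseteq> pverts G" using D(1) by (simp add: dominating_set_def)
  then have finD: "finite D" using fin by (rule finite_subset)
  have "dominating_set G (pverts G - D)"
    unfolding dominating_set_def
  proof (intro conjI ballI)
    fix d assume "d \<in> pverts G - (pverts G - D)"
    then have d: "d \<in> D" by auto
    \<comment> \<open>By minimality, \<open>D\<close> without \<open>d\<close> fails to dominate
      some \<open>x\<close>: either \<open>d\<close> itself, or a vertex outside \<open>D\<close>
      whose only neighbor in \<open>D\<close> is \<open>d\<close>.\<close>
    have "card (D - {d}) < card D" using finD d by (rule card_Diff1_less)
    then have "\<not> dominating_set G (D - {d})"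
      using domination_number_le[OF fin, of "D - {d}"] D(2) by linarith
    then obtain x where x: "x \<in> pverts G" "x \<notin> D - {d}"
      "\<And>v. v \<in> D - {d} \<Longrightarrow> x \<notin> open_neighborhood G v"
      using sub unfolding dominating_set_def by auto
    show "\<exists>v\<in>pverts G - D. d \<in> open_neighborhood G v"
    proof (cases "x = d")
      case True
      obtain y where y: "(d, y) \<in> parcs G" using noiso d sub by blast
      \<comment> \<open>A neighbor of \<open>d\<close> inside \<open>D\<close> would dominate
        \<open>d\<close>, so \<open>y\<close> lies in the complement and dominates \<open>d\<close>
        from there.\<close>
      then have "y \<notin> D"
        using x True no_loops'[OF y] arcs_symmetric[OF y]
        by (auto simp: open_neighborhood_def)
      then show ?thesis
        using y arcs_symmetric[OF y] wellformed'[OF y] by (auto simp: open_neighborhood_def)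
    next
      case False
      then have xD: "x \<notin> D" using x(2) by simp
      then obtain v where "v \<in> D" "x \<in> open_neighborhood G v"
        using D(1) x(1) by (auto simp: dominating_set_def)
      then have "(d, x) \<in> parcs G" using x(3) by (auto simp: open_neighborhood_def)
      then show ?thesis
        using xD x(1) arcs_symmetric sub d by (auto simp: open_neighborhood_def)
    qed
  qed simp
  then have "domination_number G \<le> card (pverts G - D)"
    by (rule domination_number_le[OF fin])
  then show ?thesis
    using D(2) card_Diff_subset[OF finD sub] card_mono[OF fin sub] by linarith
qed

section \<open>Trees\<close>

text \<open>Connectedness is defined through the symmetric closure, which adds no arcs to a
  symmetric digraph.\<close>

lemma undirected_tree_reachable:
  assumes "undirected_tree T" "x \<in> pverts T" "y \<in> pverts T"
  shows "x \<rightarrow>\<^sup>*\<^bsub>with_proj T\<^esub> y"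
proof -
  interpret pair_graph T using assms(1) by (simp add: undirected_tree_def)
  have "x \<rightarrow>\<^sup>*\<^bsub>with_proj (mk_symmetric (with_proj T))\<^esub> y"
    using assms unfolding undirected_tree_def connected_def strongly_connected_def by auto
  then show ?thesis using reachable_mk_symmetric_eq pair_sym_arcs by blast
qed

text \<open>A second vertex exists and is reachable from \<open>x\<close>; the first arc on the way
  leads to a neighbor.\<close>

lemma nontrivial_tree_has_neighbor:
  assumes "nontrivial_tree T" "x \<in> pverts T"
  shows "\<exists>y. (x, y) \<in> parcs T"
proof -
  have tree: "undirected_tree T" and card: "2 \<le> card (pverts T)"
    using assms(1) by (auto simp: nontrivial_tree_def)
  interpret pair_graph T using tree by (simp add: undirected_tree_def)
  obtain y where y: "y \<in> pverts T" "y \<noteq> x"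
  proof -
    have "\<not> pverts T \<subseteq> {x}" using card card_mono[of "{x}" "pverts T"] by auto
    then show ?thesis using that by blast
  qed
  have "x \<rightarrow>\<^sup>*\<^bsub>with_proj T\<^esub> y"
    using undirected_tree_reachable[OF tree assms(2) y(1)] .
  then show ?thesis
    using y(2) by (cases rule: converse_reachable_cases) auto
qed

text \<open>\<open>A\<close> is the component of \<open>u\<close> after the edge \<open>uv\<close> has been deleted.\<close>

lemma undirected_tree_edge_cut:
  assumes "undirected_tree T" and uv: "(u, v) \<in> parcs T"
  obtains A where "u \<in> A" "v \<notin> A"
    "\<And>x y. (x, y) \<in> parcs T \<Longrightarrow> (x, y) \<noteq> (u, v) \<Longrightarrow> (x, y) \<noteq> (v, u) \<Longrightarrow> x \<in> A \<Longrightarrow> y \<in> A"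
proof -
  interpret pair_graph T using assms(1) by (simp add: undirected_tree_def)
  define G where "G = \<lparr>pverts = pverts T, parcs = parcs T - {(u, v), (v, u)}\<rparr>"
  interpret G: pair_wf_digraph G
    by unfold_locales (auto simp: G_def dest: wellformed')
  define A where "A = {x. u \<rightarrow>\<^sup>*\<^bsub>with_proj G\<^esub> x}"
  have "u \<in> A"
    using wellformed'[OF uv] G.reachable_refl by (simp add: A_def G_def)
  moreover have "v \<notin> A"
  proof
    assume "v \<in> A"
    \<comment> \<open>A path from \<open>u\<close> to \<open>v\<close> that avoids the deleted edge
      would close up to a cycle with the arc \<open>(v, u)\<close>.\<close>
    then obtain p where p: "G.apath u p v" by (auto simp: A_def G.reachable_apath)
    have walk: "awalk u p v" and dist: "distinct (pawalk_verts u p)"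
      and avoid: "(u, v) \<notin> set p"
      using p unfolding G.apath_def G.awalk_def awalk_def by (auto simp: G_def)
    have "u \<noteq> v" using no_loops'[OF uv] .
    \<comment> \<open>A path of a single arc could only be the deleted \<open>(u, v)\<close>. With
      the closing arc, the length reaches the bound 3 that separates true cycles from walks back and
      forth along an edge.\<close>
    then have "2 \<le> length p"
      using walk avoid by (cases p; cases "tl p") (auto simp: awalk_def)
    have vu: "awalk v [(v, u)] u"
      using arcs_symmetric[OF uv] wellformed'[OF uv] by (auto simp: awalk_def)
    have cyc: "awalk u (p @ [(v, u)]) u"
      using walk vu by (rule awalk_appendI)
    have "pawalk_verts u (p @ [(v, u)]) = pawalk_verts u p @ [u]"
      using awalk_verts_append[OF cyc] walk by simp
    moreover have "pawalk_verts u p = u # tl (pawalk_verts u p)"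
      using walk by (cases p) (auto simp: awalk_def)
    \<comment> \<open>This tail is the vertex list of the path rotated by one place, so distinctness
      carries over.\<close>
    ultimately have "distinct (tl (pawalk_verts u (p @ [(v, u)])))"
      using dist
      by (metis distinct.simps(2) distinct1_rotate list.sel(3) rotate1.simps(2) append_Cons)
    then have "cycle (p @ [(v, u)])"
      using cyc by (auto simp: cycle_def)
    moreover have "3 \<le> length (p @ [(v, u)])" using \<open>2 \<le> length p\<close> by simp
    ultimately show False using assms(1) by (auto simp: undirected_tree_def)
  qed
  moreover have "y \<in> A"
    if "(x, y) \<in> parcs T" "(x, y) \<noteq> (u, v)" "(x, y) \<noteq> (v, u)" "x \<in> A" for x y
  proof -
    have "(x, y) \<in> parcs G" using that by (simp add: G_def)
    then show ?thesis using that(4) G.reachable_adj_trans by (auto simp: A_def)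
  qed
  ultimately show thesis by (rule that)
qed

section \<open>Coronas\<close>

text \<open>A corona seen from inside: \<open>m\<close> matches each leaf outside \<open>W\<close> with its only neighbor, in \<open>W\<close>.\<close>

definition leaf_matching :: "'a pair_pre_digraph \<Rightarrow> ('a \<Rightarrow> 'a) \<Rightarrow> 'a set \<Rightarrow> bool" where
  "leaf_matching G m W \<longleftrightarrow> W \<subseteq> pverts G \<and>
     (\<forall>x \<in> pverts G. m x \<in> pverts G \<and> m (m x) = x \<and> (m x \<in> W \<longleftrightarrow> x \<notin> W)) \<and>
     (\<forall>x \<in> pverts G - W. open_neighborhood G x = {m x})"

section \<open>Isomorphism with a corona\<close>

text \<open>An arc of a pair digraph is the pair of its ends, so the vertex map determines the arc
  map. Later arguments can thus work with a single function on vertices.\<close>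

lemma digraph_iso_with_proj:
  fixes G :: "'a pair_pre_digraph" and H :: "'b pair_pre_digraph"
  assumes "pair_wf_digraph G"
  shows "digraph_iso (with_proj G) (with_proj H) \<longleftrightarrow>
    (\<exists>f. inj_on f (pverts G) \<and> pverts H = f ` pverts G \<and> parcs H = map_prod f f ` parcs G)"
proof
  interpret pair_wf_digraph G by fact
  assume "digraph_iso (with_proj G) (with_proj H)"
  then obtain h where h: "digraph_isomorphism h" "with_proj H = app_iso h (with_proj G)"
    by (auto simp: digraph_iso_def)
  have tl: "iso_tail h = fst" and hd: "iso_head h = snd"
    and V: "pverts H = iso_verts h ` pverts G" and E: "parcs H = iso_arcs h ` parcs G"
    using h(2) by (auto simp: with_proj_def app_iso_def)
  have "iso_arcs h e = map_prod (iso_verts h) (iso_verts h) e" if "e \<in> parcs G" for e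
    using h(1) that unfolding digraph_isomorphism_def tl hd
    by (auto simp: prod_eq_iff)
  then have "parcs H = map_prod (iso_verts h) (iso_verts h) ` parcs G"
    unfolding E by (rule image_cong[OF refl])
  then show "\<exists>f. inj_on f (pverts G) \<and> pverts H = f ` pverts G \<and>
      parcs H = map_prod f f ` parcs G"
    using h(1) V unfolding digraph_isomorphism_def by auto
next
  interpret pair_wf_digraph G by fact
  assume "\<exists>f. inj_on f (pverts G) \<and> pverts H = f ` pverts G \<and> parcs H = map_prod f f ` parcs G"
  then obtain f where f: "inj_on f (pverts G)" "pverts H = f ` pverts G"
    "parcs H = map_prod f f ` parcs G" by blast
  define h where "h = \<lparr>iso_verts = f, iso_arcs = map_prod f f, iso_head = snd, iso_tail = fst\<rparr>"
  have "inj_on (map_prod f f) (parcs G)"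
  proof (rule inj_onI)
    fix e e' assume e: "e \<in> parcs G" "e' \<in> parcs G" "map_prod f f e = map_prod f f e'"
    then have "f (fst e) = f (fst e')" "f (snd e) = f (snd e')" by (auto simp: prod_eq_iff)
    then show "e = e'"
      using f(1) e arc_fst_in_verts arc_snd_in_verts by (auto simp: prod_eq_iff dest: inj_onD)
  qed
  then have "digraph_isomorphism h"
    unfolding digraph_isomorphism_def h_def using f(1) wf_digraph by auto
  moreover have "with_proj H = app_iso h (with_proj G)"
    using f by (simp add: with_proj_def app_iso_def h_def)
  ultimately show "digraph_iso (with_proj G) (with_proj H)"
    by (auto simp: digraph_iso_def)
qed

text \<open>The base of the corona is the subgraph induced on \<open>W\<close>. Every arc with an
  end outside \<open>W\<close> is a matching arc, and these become the pendant edges.\<close>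

lemma leaf_matching_imp_corona:
  assumes "pair_graph G" and M: "leaf_matching G m W"
  shows "digraph_iso (with_proj G) (with_proj (corona_K1 \<lparr>pverts = W, parcs = parcs G \<inter> W \<times> W\<rparr>))"
proof -
  interpret pair_graph G by fact
  \<comment> \<open>A vertex outside \<open>W\<close> becomes the leaf attached to its partner
    \<open>m x\<close>, hence the argument of \<open>Inr\<close>.\<close>
  define f where "f x = (if x \<in> W then Inl x else Inr (m x))" for x
  have sub: "W \<subseteq> pverts G"
    and m: "\<And>x. x \<in> pverts G \<Longrightarrow> m x \<in> pverts G \<and> m (m x) = x \<and> (m x \<in> W \<longleftrightarrow> x \<notin> W)"
    and N: "\<And>x. x \<in> pverts G \<Longrightarrow> x \<notin> W \<Longrightarrow> open_neighborhood G x = {m x}"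
    using M by (auto simp: leaf_matching_def)
  have leaf: "y = m x" if "(x, y) \<in> parcs G" "x \<notin> W" for x y
    using N[of x] that wellformed'[OF that(1)] by (auto simp: open_neighborhood_def)
  have leaf': "x = m y" if "(x, y) \<in> parcs G" "y \<notin> W" for x y
    using leaf that arcs_symmetric by blast
  have match: "(x, m x) \<in> parcs G" if "x \<in> pverts G" for x
  proof (cases "x \<in> W")
    case True
    then have "open_neighborhood G (m x) = {x}" using N m that by metis
    then have "(m x, x) \<in> parcs G" by (auto simp: open_neighborhood_def)
    then show ?thesis by (rule arcs_symmetric)
  next
    case False
    then show ?thesis using N[OF that] by (auto simp: open_neighborhood_def)
  qed
  have "inj_on f (pverts G)"
    by (rule inj_onI) (auto simp: f_def split: if_splits dest: m, metis m)
  moreover have "f ` pverts G = Inl ` W \<union> Inr ` W"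
  proof (intro equalityI subsetI)
    fix z assume "z \<in> Inl ` W \<union> Inr ` W"
    then show "z \<in> f ` pverts G"
    proof
      assume "z \<in> Inl ` W"
      then show ?thesis using sub by (auto simp: f_def image_iff)
    next
      assume "z \<in> Inr ` W"
      then obtain w where w: "w \<in> W" "z = Inr w" by blast
      then have "f (m w) = z" "m w \<in> pverts G" using m[of w] sub by (auto simp: f_def)
      then show ?thesis by blast
    qed
  qed (auto simp: f_def m)
  moreover have "map_prod f f ` parcs G = parcs (corona_K1 \<lparr>pverts = W, parcs = parcs G \<inter> W \<times> W\<rparr>)"
    (is "?L = ?R")
  proof (intro equalityI subsetI)
    fix z assume "z \<in> ?L"
    then obtain x y where xy: "(x, y) \<in> parcs G" "z = (f x, f y)" by auto
    note V = wellformed'[OF xy(1)]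
    \<comment> \<open>The last two cases exclude each other: the only neighbor of a vertex outside
      \<open>W\<close> is its partner, which is in \<open>W\<close>.\<close>
    consider "x \<in> W" "y \<in> W" | "x \<notin> W" | "y \<notin> W" by blast
    then show "z \<in> ?R"
    proof cases
      case 1 then show ?thesis using xy by (simp add: f_def corona_K1_def)
    next
      case 2
      then have "y = m x" "y \<in> W" using leaf xy m V by auto
      then show ?thesis using 2 xy(2) by (simp add: f_def corona_K1_def)
    next
      case 3
      then have "x = m y" "x \<in> W" using leaf' xy m V by auto
      then show ?thesis using 3 xy(2) by (simp add: f_def corona_K1_def)
    qed
  next
    fix z assume "z \<in> ?R"
    then consider x y where "z = (Inl x, Inl y)" "(x, y) \<in> parcs G" "x \<in> W" "y \<in> W"
      | w where "z = (Inl w, Inr w)" "w \<in> W" | w where "z = (Inr w, Inl w)" "w \<in> W"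
      by (auto simp: corona_K1_def)
    then show "z \<in> ?L"
    proof cases
      case 1
      then have "z = map_prod f f (x, y)" by (simp add: f_def)
      then show ?thesis using 1(2) by blast
    next
      case (2 w)
      then have "z = map_prod f f (w, m w)" using m[of w] sub by (auto simp: f_def)
      moreover have "(w, m w) \<in> parcs G" using match 2 sub by blast
      ultimately show ?thesis by blast
    next
      case (3 w)
      then have "z = map_prod f f (m w, w)" using m[of w] sub by (auto simp: f_def)
      moreover have "(m w, w) \<in> parcs G" using match 3 sub arcs_symmetric by blast
      ultimately show ?thesis by blast
    qed
  qed
  ultimately show ?thesis
    unfolding digraph_iso_with_proj[OF pair_wf_digraph]
    by (intro exI[of _ f]) (simp add: corona_K1_def)
qed

text \<open>The exchange of each base vertex with its leaf is pulled back along the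
  isomorphism.\<close>

lemma corona_imp_leaf_matching:
  assumes "pair_wf_digraph G" and "digraph_iso (with_proj G) (with_proj (corona_K1 H))"
  obtains m W where "leaf_matching G m W"
proof -
  interpret pair_wf_digraph G by fact
  obtain f where inj: "inj_on f (pverts G)" and V: "pverts (corona_K1 H) = f ` pverts G"
    and E: "parcs (corona_K1 H) = map_prod f f ` parcs G"
    using assms(2) unfolding digraph_iso_with_proj[OF assms(1)] by blast
  define g where "g = the_inv_into (pverts G) f"
  \<comment> \<open>\<open>s\<close> swaps a base vertex with its leaf; \<open>m\<close> is
    \<open>s\<close> conjugated by \<open>f\<close>, and \<open>W\<close> is the preimage of the
    base.\<close>
  define s :: "'b + 'b \<Rightarrow> 'b + 'b" where "s = case_sum Inr Inl"
  define m where "m x = g (s (f x))" for x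
  define W where "W = {x \<in> pverts G. isl (f x)}"
  have g: "g z \<in> pverts G \<and> f (g z) = z" if "z \<in> pverts (corona_K1 H)" for z
    using inj that unfolding g_def V
    by (auto simp: f_the_inv_into_f the_inv_into_into)
  have gf: "g (f x) = x" if "x \<in> pverts G" for x
    using inj that by (simp add: g_def the_inv_into_f_f)
  have s: "s z \<in> pverts (corona_K1 H) \<and> s (s z) = z \<and> (isl (s z) \<longleftrightarrow> \<not> isl z)"
    if "z \<in> pverts (corona_K1 H)" for z
    using that by (auto simp: corona_K1_def s_def)
  have fV: "f x \<in> pverts (corona_K1 H)" if "x \<in> pverts G" for x using that V by blast
  have arc: "(x, y) \<in> parcs G \<longleftrightarrow> (f x, f y) \<in> parcs (corona_K1 H)"
    if "x \<in> pverts G" "y \<in> pverts G" for x y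
  proof
    assume "(x, y) \<in> parcs G"
    then show "(f x, f y) \<in> parcs (corona_K1 H)" unfolding E by force
  next
    assume "(f x, f y) \<in> parcs (corona_K1 H)"
    then obtain a b where ab: "(a, b) \<in> parcs G" "f x = f a" "f y = f b" unfolding E by auto
    then have "x = a" "y = b" using inj that wellformed'[OF ab(1)] by (auto dest: inj_onD)
    then show "(x, y) \<in> parcs G" using ab(1) by simp
  qed
  have nb: "(z, z') \<in> parcs (corona_K1 H) \<longleftrightarrow> z' = s z"
    if "z \<in> pverts (corona_K1 H)" "\<not> isl z" for z z'
    using that by (auto simp: corona_K1_def s_def)
  have fm: "m x \<in> pverts G \<and> f (m x) = s (f x)" if "x \<in> pverts G" for x
    using g s fV that unfolding m_def by blast
  have mm: "m (m x) = x" if "x \<in> pverts G" for x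
    using fm[OF that] s[OF fV[OF that]] gf[OF that] by (simp add: m_def)
  have "open_neighborhood G x = {m x}" if x: "x \<in> pverts G - W" for x
  proof -
    have "(x, y) \<in> parcs G \<longleftrightarrow> y = m x" if "y \<in> pverts G" for y
      using arc[of x y] nb[of "f x" "f y"] fV[of x] fm[of x] x that gf[of y] gf[of "m x"]
      by (auto simp: W_def)
    then show ?thesis using fm x by (auto simp: open_neighborhood_def)
  qed
  then have "leaf_matching G m W"
    using fm mm s fV by (auto simp: leaf_matching_def W_def)
  then show thesis by (rule that)
qed

text \<open>Contracting the leaf edges turns walks of \<open>T\<close> into walks inside
  \<open>W\<close>, which gives connectedness. Acyclicity passes to subgraphs.\<close>

lemma undirected_tree_delete_leaves:
  assumes "undirected_tree T" and M: "leaf_matching T m W"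
  shows "undirected_tree \<lparr>pverts = W, parcs = parcs T \<inter> W \<times> W\<rparr>" (is "undirected_tree ?H")
proof -
  interpret pair_graph T using assms(1) by (simp add: undirected_tree_def)
  have sub: "W \<subseteq> pverts T"
    and m: "\<And>x. x \<in> pverts T \<Longrightarrow> m x \<in> pverts T \<and> m (m x) = x \<and> (m x \<in> W \<longleftrightarrow> x \<notin> W)"
    and N: "\<And>x. x \<in> pverts T \<Longrightarrow> x \<notin> W \<Longrightarrow> open_neighborhood T x = {m x}"
    using M by (auto simp: leaf_matching_def)
  interpret H: pair_graph ?H
  proof unfold_locales
    show "finite (pverts ?H)" using finite_subset[OF sub pair_finite_verts] by simp
    show "finite (parcs ?H)" using pair_finite_arcs by auto
    show "symmetric (with_proj ?H)"
      using arcs_symmetric by (auto simp: symmetric_def intro!: symI)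
  qed (auto dest: no_loops')
  define r where "r x = (if x \<in> W then x else m x)" for x
  \<comment> \<open>\<open>r\<close> retracts the tree onto \<open>W\<close>, contracting each leaf edge.\<close>
  have leaf: "y = m x" if "(x, y) \<in> parcs T" "x \<notin> W" for x y
    using N[of x] that wellformed'[OF that(1)] by (auto simp: open_neighborhood_def)
  have rW: "r x \<in> W" if "x \<in> pverts T" for x using m[OF that] by (simp add: r_def)
  \<comment> \<open>An arc inside \<open>W\<close> is kept; any other arc is a leaf edge and
    collapses to a point.\<close>
  have r_arc: "r x = r y \<or> (r x, r y) \<in> parcs ?H" if xy: "(x, y) \<in> parcs T" for x y
  proof -
    note V = wellformed'[OF xy]
    consider "x \<in> W" "y \<in> W" | "x \<notin> W" | "y \<notin> W" by blast
    then show ?thesis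
    proof cases
      case 2
      then show ?thesis using leaf[OF xy] m V by (simp add: r_def)
    next
      case 3
      then show ?thesis using leaf[OF arcs_symmetric[OF xy]] m V by (simp add: r_def)
    qed (use xy in \<open>simp add: r_def\<close>)
  qed
  have reach: "r x \<rightarrow>\<^sup>*\<^bsub>with_proj ?H\<^esub> r y" if "x \<rightarrow>\<^sup>*\<^bsub>with_proj T\<^esub> y" for x y
    using that
  proof (induction rule: reachable_induct)
    case base
    then show ?case using rW by auto
  next
    case (step y z)
    then show ?case
      using r_arc[of y z]
      by (metis H.reachable_adj_trans)
  qed
  have "x \<rightarrow>\<^sup>*\<^bsub>with_proj ?H\<^esub> y" if "x \<in> W" "y \<in> W" for x y
  proof -
    have "x \<rightarrow>\<^sup>*\<^bsub>with_proj T\<^esub> y"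
      using undirected_tree_reachable[OF assms(1)] sub that by blast
    from reach[OF this] show ?thesis using that by (simp add: r_def)
  qed
  moreover have "W \<noteq> {}"
  proof -
    have "pverts T \<noteq> {}"
      using assms(1)
      unfolding undirected_tree_def connected_def strongly_connected_def by simp
    then show ?thesis using rW by blast
  qed
  ultimately have "connected (with_proj ?H)"
    unfolding connected_def strongly_connected_def
    by (auto simp: H.reachable_mk_symmetric_eq[OF H.pair_sym_arcs])
  moreover have "cycle p" if "H.cycle p" for p
    using that sub by (auto simp: H.cycle_def cycle_def H.awalk_def awalk_def)
  ultimately show ?thesis
    using assms(1) H.pair_graph unfolding undirected_tree_def by blast
qed

section \<open>Leaf matchings and equality of the two numbers\<close>

text \<open>The leaves outside \<open>W\<close> form a super dominating set of at most
  \<open>card W\<close> vertices, and every dominating set must contain an end of each of the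
  \<open>card W\<close> disjoint leaf edges. Both numbers are squeezed to
  \<open>card W\<close>.\<close>

lemma leaf_matching_imp_equal_numbers:
  assumes "pair_graph G" and M: "leaf_matching G m W"
  shows "domination_number G = super_domination_number G"
proof -
  interpret pair_graph G by fact
  have fin: "finite (pverts G)" by (rule pair_finite_verts)
  have sub: "W \<subseteq> pverts G"
    and m: "\<And>x. x \<in> pverts G \<Longrightarrow> m x \<in> pverts G \<and> m (m x) = x \<and> (m x \<in> W \<longleftrightarrow> x \<notin> W)"
    and N: "\<And>x. x \<in> pverts G \<Longrightarrow> x \<notin> W \<Longrightarrow> open_neighborhood G x = {m x}"
    using M by (auto simp: leaf_matching_def)
  have "super_dominating_set G (pverts G - W)"
    unfolding super_dominating_set_def
  proof (intro conjI ballI)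
    fix u assume "u \<in> pverts G - (pverts G - W)"
    then have u: "u \<in> W" "u \<in> pverts G" by auto
    then have "open_neighborhood G (m u) = {u}" using N[of "m u"] m by simp
    then show "\<exists>v\<in>pverts G - W. open_neighborhood G v \<inter> (pverts G - (pverts G - W)) = {u}"
      using u m by (intro bexI[of _ "m u"]) auto
  qed simp
  then have "super_domination_number G \<le> card (pverts G - W)"
    by (rule super_domination_number_le[OF fin])
  also have "\<dots> \<le> card W"
    using m sub fin
    by (intro card_inj_on_le[of m]) (auto intro!: inj_onI intro: finite_subset, metis)
  also have "\<dots> \<le> domination_number G"
  proof -
    obtain D where D: "dominating_set G D" "card D = domination_number G"
      using domination_number_attained[OF fin] .
    have subD: "D \<subseteq> pverts G" using D(1) by (simp add: dominating_set_def)
    \<comment> \<open>A leaf outside \<open>D\<close> can be dominated only by its sole neighbor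
      \<open>w\<close>.\<close>
    have hit: "m w \<in> D" if w: "w \<in> W" "w \<notin> D" for w
    proof (rule ccontr)
      assume "m w \<notin> D"
      have V: "w \<in> pverts G" using w sub by blast
      then obtain v where v: "v \<in> D" "m w \<in> open_neighborhood G v"
        using D(1) m \<open>m w \<notin> D\<close> unfolding dominating_set_def by blast
      then have "v \<in> open_neighborhood G (m w)"
        using arcs_symmetric subD by (auto simp: open_neighborhood_def)
      moreover have "open_neighborhood G (m w) = {w}" using N[of "m w"] m[OF V] w by simp
      ultimately show False using v w by simp
    qed
    \<comment> \<open>\<open>f\<close> picks an end in \<open>D\<close> of the leaf edge at
      \<open>w\<close>; it is injective because these edges are disjoint.\<close>
    define f where "f w = (if w \<in> D then w else m w)" for w
    have "inj_on f W"
    proof (rule inj_onI)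
      fix x y assume "x \<in> W" "y \<in> W" "f x = f y"
      then show "x = y"
        using m[of x] m[of y] sub by (auto simp: f_def split: if_splits)
    qed
    moreover have "f ` W \<subseteq> D" using hit by (auto simp: f_def)
    ultimately have "card W \<le> card D"
      using finite_subset[OF subD fin] by (rule card_inj_on_le)
    then show ?thesis using D(2) by simp
  qed
  finally show ?thesis
    using domination_number_le_super_domination_number[OF fin] by simp
qed

text \<open>Acyclicity enters through the edge cut: on the four-cycle both numbers are 2, yet there
  is no leaf.\<close>

lemma equal_numbers_imp_leaf_matching:
  assumes "nontrivial_tree T" and eq: "domination_number T = super_domination_number T"
  obtains m W where "leaf_matching T m W"
proof -
  have tree: "undirected_tree T" using assms(1) by (simp add: nontrivial_tree_def)
  interpret pair_graph T using tree by (simp add: undirected_tree_def)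
  have fin: "finite (pverts T)" by (rule pair_finite_verts)
  \<comment> \<open>Half the order lies between the two numbers, so their equality pins both to
    it.\<close>
  have half: "2 * domination_number T = card (pverts T)"
    using double_domination_number_le_card[OF pair_graph nontrivial_tree_has_neighbor[OF assms(1)]]
      card_le_double_super_domination_number[OF fin] eq by linarith
  obtain S where S: "super_dominating_set T S" "card S = domination_number T"
    using super_domination_number_attained[OF fin] eq by metis
  have sub: "S \<subseteq> pverts T" using S(1) by (simp add: super_dominating_set_def)
  then have finS: "finite S" using fin by (rule finite_subset)
  define S' where "S' = pverts T - S"
  have cardS': "card S' = domination_number T"
    using half S(2) card_Diff_subset[OF finS sub] by (simp add: S'_def)
  obtain f where f: "f ` S' \<subseteq> S" "inj_on f S'"
    "\<And>u. u \<in> S' \<Longrightarrow> open_neighborhood T (f u) \<inter> S' = {u}"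
    using super_dominating_set_private_neighbors[OF S(1)] unfolding S'_def by metis
  have onto: "f ` S' = S"
    using f(1) finS card_image[OF f(2)] cardS' S(2) by (intro card_subset_eq) auto
  \<comment> \<open>As \<open>f\<close> is a bijection from \<open>S'\<close> onto \<open>S\<close>,
    joining it with its inverse gives an involution of the vertices.\<close>
  define m where "m x = (if x \<in> S then the_inv_into S' f x else f x)" for x
  have mS': "m u \<in> S" "m (m u) = u" if "u \<in> S'" for u
    using that f(1,2) by (auto simp: m_def S'_def the_inv_into_f_f)
  have mS: "m v \<in> S'" "m (m v) = v" if v: "v \<in> S" for v
  proof -
    obtain u where u: "u \<in> S'" "v = f u" using v onto by blast
    then have "m v = u" using v f(2) by (simp add: m_def the_inv_into_f_f)
    then show "m v \<in> S'" "m (m v) = v" using u by (auto simp: m_def S'_def)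
  qed
  \<comment> \<open>Since \<open>v\<close> is the private neighbor of \<open>m v\<close>, it sees
    nothing else in \<open>S'\<close>: only matching edges run between \<open>S\<close> and
    \<open>S'\<close>.\<close>
  have cross: "u = m v" if vu: "(v, u) \<in> parcs T" "v \<in> S" "u \<in> S'" for u v
  proof -
    have "v = f (m v)" using mS[OF vu(2)] by (simp add: m_def S'_def)
    then have "u \<in> open_neighborhood T (f (m v)) \<inter> S'"
      using vu wellformed' by (auto simp: open_neighborhood_def)
    then show ?thesis using f(3)[OF mS(1)[OF vu(2)]] by simp
  qed
  have mV: "m x \<in> pverts T" "m (m x) = x" if "x \<in> pverts T" for x
    using that mS[of x] mS'[of x] sub by (auto simp: S'_def)
  have arcS': "(m u, u) \<in> parcs T" if u: "u \<in> S'" for u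
    using f(3)[OF u] u by (auto simp: m_def open_neighborhood_def S'_def)
  have arc: "(x, m x) \<in> parcs T" if "x \<in> pverts T" for x
  proof (cases "x \<in> S")
    case True
    then show ?thesis using arcS'[of "m x"] mS[of x] by simp
  next
    case False
    then show ?thesis using arcS'[of x] arcs_symmetric that by (simp add: S'_def)
  qed
  have leaf: "open_neighborhood T u = {m u} \<or> open_neighborhood T (m u) = {u}" if u: "u \<in> S'" for u
  proof (rule ccontr)
    assume no: "\<not> ?thesis"
    define v where "v = m u"
    have vS: "v \<in> S" and muv: "m u = v" "m v = u" using mS'[OF u] by (auto simp: v_def)
    have uV: "u \<in> pverts T" and vV: "v \<in> pverts T" using u vS sub by (auto simp: S'_def)
    have uv: "(u, v) \<in> parcs T" using arc[OF uV] muv by simp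
    have uS: "u \<notin> S" and vS': "v \<notin> S'" using u vS by (auto simp: S'_def)
    have "open_neighborhood T u \<noteq> {v}" using no muv by simp
    then obtain u' where u': "(u, u') \<in> parcs T" "u' \<noteq> v"
      using uv vV by (auto simp: open_neighborhood_def)
    \<comment> \<open>The only arc from \<open>u\<close> into \<open>S\<close> goes to
      \<open>v\<close>, so the further neighbor \<open>u'\<close> stays in \<open>S'\<close>.
      Likewise \<open>v'\<close> stays in \<open>S\<close>.\<close>
    have "u' \<in> S'"
      using cross[OF arcs_symmetric[OF u'(1)] _ u] mS(2)[of u'] wellformed'[OF u'(1)] muv u'(2)
      by (auto simp: S'_def)
    have "open_neighborhood T v \<noteq> {u}" using no muv by simp
    then obtain v' where v': "(v, v') \<in> parcs T" "v' \<noteq> u"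
      using arcs_symmetric[OF uv] uV by (auto simp: open_neighborhood_def)
    have "v' \<in> S"
      using cross[OF v'(1) vS] wellformed'[OF v'(1)] muv v'(2) by (auto simp: S'_def)
    obtain A where A: "u \<in> A" "v \<notin> A"
      "\<And>x y. (x, y) \<in> parcs T \<Longrightarrow> (x, y) \<noteq> (u, v) \<Longrightarrow> (x, y) \<noteq> (v, u) \<Longrightarrow> x \<in> A \<Longrightarrow> y \<in> A"
      using undirected_tree_edge_cut[OF tree uv] by metis
    \<comment> \<open>\<open>A\<close> is the side of \<open>u\<close>. Each matching edge other
      than \<open>uv\<close> lies on one side and gives exactly one end to \<open>D\<close>, while
      \<open>uv\<close> gives none; \<open>u\<close> and \<open>v\<close> are dominated by
      \<open>u'\<close> and \<open>v'\<close>.\<close>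
    define D where "D = (S' \<inter> A - {u}) \<union> (S - A - {v})"
    have D_sub: "D \<subseteq> pverts T" using sub by (auto simp: D_def S'_def)
    have u'D: "u' \<in> D"
      using A(3)[OF u'(1)] A(1) u'(2) \<open>u' \<in> S'\<close> uv no_loops'[OF u'(1)] no_loops'[OF uv]
      by (auto simp: D_def)
    have v'D: "v' \<in> D"
      using A(3)[OF arcs_symmetric[OF v'(1)]] A(2) v'(2) \<open>v' \<in> S\<close> no_loops'[OF v'(1)]
      by (auto simp: D_def)
    \<comment> \<open>The cut separates only the ends of \<open>uv\<close>, so every other matching
      edge stays within one side.\<close>
    have sameside: "m x \<in> A \<longleftrightarrow> x \<in> A" if "x \<in> pverts T" "x \<noteq> u" "x \<noteq> v" for x
      using A(3)[OF arc[OF that(1)]] A(3)[OF arcs_symmetric[OF arc[OF that(1)]]]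
        that mV[OF that(1)] muv by auto
    have cover: "x \<in> D \<or> m x \<in> D" if "x \<in> pverts T" "x \<noteq> u" "x \<noteq> v" for x
      using sameside[OF that] that mS[of x] mS'[of x] mV(2)[OF that(1)] muv
      by (auto simp: D_def S'_def)
    have "dominating_set T D"
      unfolding dominating_set_def
    proof (intro conjI ballI)
      fix x assume x: "x \<in> pverts T - D"
      consider "x = u" | "x = v" | "x \<noteq> u" "x \<noteq> v" by blast
      then show "\<exists>y\<in>D. x \<in> open_neighborhood T y"
      proof cases
        case 1
        then show ?thesis
          using u'D uV arcs_symmetric[OF u'(1)] by (auto simp: open_neighborhood_def)
      next
        case 2
        then show ?thesis
          using v'D vV arcs_symmetric[OF v'(1)] by (auto simp: open_neighborhood_def)
      next
        case 3
        then show ?thesis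
          using cover[of x] x arcs_symmetric[OF arc[of x]]
          by (intro bexI[of _ "m x"]) (auto simp: open_neighborhood_def)
      qed
    qed (rule D_sub)
    then have "domination_number T \<le> card D" by (rule domination_number_le[OF fin])
    \<comment> \<open>Each vertex of \<open>D\<close> is sent to the end in \<open>S\<close> of its
      matching edge. Two vertices with the same image would be the ends of one edge on different
      sides of the cut; \<open>v\<close> is never hit because \<open>u\<close> is left out.\<close>
    also have "card D \<le> card (S - {v})"
    proof (rule card_inj_on_le[of "\<lambda>x. if x \<in> S then x else m x"])
      show "inj_on (\<lambda>x. if x \<in> S then x else m x) D"
      proof (rule inj_onI)
        fix x y assume "x \<in> D" "y \<in> D" and xy: "(if x \<in> S then x else m x) = (if y \<in> S then y else m y)"
        then show "x = y"
          using sameside[of x] sameside[of y] mV[of x] mV[of y] D_sub A muv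
          by (auto simp: D_def S'_def split: if_splits)
      qed
      have "m x \<noteq> v" if "x \<in> S'" "x \<noteq> u" for x
        using mS'(2)[OF that(1)] that(2) muv(2) by auto
      then show "(\<lambda>x. if x \<in> S then x else m x) ` D \<subseteq> S - {v}"
        using mS'(1) by (auto simp: D_def S'_def)
    qed (use finS in simp)
    also have "\<dots> < card S" using finS vS by (rule card_Diff1_less)
    finally show False using S(2) by simp
  qed
  \<comment> \<open>From each matching edge \<open>W\<close> takes the end in \<open>S'\<close> if
    the end in \<open>S\<close> is a leaf, and otherwise the end in \<open>S\<close>. This also
    settles the case where both ends are leaves.\<close>
  define W where "W = {u \<in> S'. open_neighborhood T (m u) = {u}} \<union>
    {v \<in> S. open_neighborhood T v \<noteq> {m v}}"
  have "leaf_matching T m W"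
    unfolding leaf_matching_def
  proof (intro conjI ballI)
    show "W \<subseteq> pverts T" using sub by (auto simp: W_def S'_def)
  next
    fix x assume x: "x \<in> pverts T"
    show "m x \<in> pverts T" "m (m x) = x" using mV[OF x] by auto
    show "m x \<in> W \<longleftrightarrow> x \<notin> W"
    proof (cases "x \<in> S")
      case True
      then have "x \<notin> S'" "m x \<notin> S" using mS(1)[of x] by (auto simp: S'_def)
      then show ?thesis using True mS[OF True] by (simp add: W_def)
    next
      case False
      then have "x \<in> S'" using x by (simp add: S'_def)
      then have "m x \<notin> S'" using mS'(1)[of x] by (simp add: S'_def)
      then show ?thesis using False \<open>x \<in> S'\<close> mS'[OF \<open>x \<in> S'\<close>] by (simp add: W_def)
    qed
  next
    fix x assume x: "x \<in> pverts T - W"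
    then show "open_neighborhood T x = {m x}"
      using leaf[of x] by (auto simp: W_def S'_def)
  qed
  then show thesis by (rule that)
qed

theorem theorem2p5:
  fixes T :: "'a pair_pre_digraph"
  assumes "nontrivial_tree T"
  shows "(0 < real (domination_number T) / real (super_domination_number T) \<and>
          real (domination_number T) / real (super_domination_number T) \<le> 1) \<and>
         (real (domination_number T) / real (super_domination_number T) = 1 \<longleftrightarrow>
          (\<exists>H :: 'a pair_pre_digraph. undirected_tree H \<and>
             digraph_iso (with_proj T) (with_proj (corona_K1 H))))"
proof -
  have tree: "undirected_tree T" using assms by (simp add: nontrivial_tree_def)
  interpret pair_graph T using tree by (simp add: undirected_tree_def)
  have fin: "finite (pverts T)" by (rule pair_finite_verts)
  have "pverts T \<noteq> {}" using assms by (auto simp: nontrivial_tree_def)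
  then have pos: "0 < domination_number T" by (rule domination_number_pos[OF fin])
  have le: "domination_number T \<le> super_domination_number T"
    by (rule domination_number_le_super_domination_number[OF fin])
  have "domination_number T = super_domination_number T \<longleftrightarrow>
    (\<exists>H :: 'a pair_pre_digraph. undirected_tree H \<and>
       digraph_iso (with_proj T) (with_proj (corona_K1 H)))"
  proof
    assume "domination_number T = super_domination_number T"
    then obtain m W where "leaf_matching T m W"
      using equal_numbers_imp_leaf_matching[OF assms] by metis
    \<comment> \<open>The witness is the subgraph of \<open>T\<close> induced on
      \<open>W\<close>.\<close>
    then show "\<exists>H :: 'a pair_pre_digraph. undirected_tree H \<and>
        digraph_iso (with_proj T) (with_proj (corona_K1 H))"
      using undirected_tree_delete_leaves[OF tree] leaf_matching_imp_corona[OF pair_graph] by metis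
  next
    assume "\<exists>H :: 'a pair_pre_digraph. undirected_tree H \<and>
        digraph_iso (with_proj T) (with_proj (corona_K1 H))"
    then obtain m W where "leaf_matching T m W"
      using corona_imp_leaf_matching[OF pair_wf_digraph] by metis
    then show "domination_number T = super_domination_number T"
      by (rule leaf_matching_imp_equal_numbers[OF pair_graph])
  qed
  \<comment> \<open>The denominator is at least the positive numerator, so the convention for
    division by zero never applies.\<close>
  moreover have "real (domination_number T) / real (super_domination_number T) = 1 \<longleftrightarrow>
      domination_number T = super_domination_number T"
    using pos le by auto
  ultimately show ?thesis using pos le by simp
qed

end
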